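(* Let $\mu$ be a probability measure on $\mathbb{R}^d$ that is absolutely continuous with respect to Lebesgue measure, let $t>0$, and let $\eta$ be a Poisson point process on $\mathbb{R}^d$ with intensity measure $t\mu$. Let $\Pi_t$ be the convex hull of the points of $\eta$, and let $I(\Pi_t)$ be the number of points of $\eta$ lying in the interior of $\Pi_t$. Then for every $k\in\mathbb{N}$, $$\mathbb{E}\, I(\Pi_t)_{(k)}=t^k\,\mathbb{E}\,\mu(\Pi_t)^k,$$ where $n_{(k)}=n(n-1)\cdots(n-k+1)$ denotes the falling factorial.
   Context: A Poisson point process $\eta$ with intensity measure $t\mu$ is a random finite simple counting measure such that $\eta(A)$ is Poisson distributed with parameter $t\mu(A)$ for every Borel set $A$ and $\eta(A_1),\dots,\eta(A_m)$ are independent for pairwise disjoint Borel sets. *)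

theory Defs
  imports "HOL-Probability.Probability"
begin

text \<open>Falling factorial n_(k) = n (n-1) ... (n-k+1) (equals 0 if k > n).\<close>
definition falling_fact :: "nat \<Rightarrow> nat \<Rightarrow> nat" where
  "falling_fact n k = (\<Prod>i<k. (n - i))"

text \<open>A Poisson point process on a euclidean space, realised as a random finite
  (simple) set of points eta on the probability space M, with intensity measure t*nu:
  the counts eta(A) are Poisson(t nu(A)) distributed for every Borel set A, and
  independent for pairwise disjoint Borel sets.\<close>
definition poisson_process ::
  "'w measure \<Rightarrow> ('w \<Rightarrow> 'a::euclidean_space set) \<Rightarrow> 'a measure \<Rightarrow> real \<Rightarrow> bool" where
  "poisson_process M eta nu t \<longleftrightarrow>
     prob_space M \<and>
     (\<forall>\<omega>\<in>space M. finite (eta \<omega>)) \<and>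
     (\<forall>A\<in>sets borel.
        (\<lambda>\<omega>. card (eta \<omega> \<inter> A)) \<in> measurable M (count_space UNIV) \<and>
        (\<forall>n::nat. measure M {\<omega>\<in>space M. card (eta \<omega> \<inter> A) = n}
             = exp (- (t * measure nu A)) * (t * measure nu A) ^ n / fact n)) \<and>
     (\<forall>(I::nat set) (A::nat \<Rightarrow> 'a set). finite I \<longrightarrow> (\<forall>i\<in>I. A i \<in> sets borel) \<longrightarrow>
        disjoint_family_on A I \<longrightarrow>
        prob_space.indep_vars M (\<lambda>_. count_space UNIV) (\<lambda>i \<omega>. card (eta \<omega> \<inter> A i)) I)"

definition interior_count :: "'a::euclidean_space set \<Rightarrow> nat" where
  "interior_count P = card {x \<in> P. x \<in> interior (convex hull P)}"

end

theory Submission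
  imports Defs
begin

text \<open>
  The law of a random finite set is determined by its avoidance probabilities, so the Poisson
  process has the law of N i.i.d. points with law mu, where N is Poisson distributed with
  parameter t. For a sample of n points, which are almost surely distinct, the falling factorial of the
  number of interior points is k! times the number of k-element index sets K all of whose points are
  interior to the hull. Interior points are not extreme, so by Krein--Milman they may be removed
  without changing the hull: the points of K are interior to the hull of the whole sample iff they
  are interior to the hull of the remaining n - k points. As the boundary of a convex set is a
  null set, Fubini gives the probability of this event as the expected k-th power of the mu-measure
  of the hull of n - k points. Summing over n with the Poisson weights and shifting n by k
  produces the factor \<open>t ^ k\<close>.
\<close>

section \<open>Interiors of convex hulls of finite sets\<close>

text \<open>By Krein-Milman the large hull is spanned by its extreme points. These belong to
  \<open>A \<union> B\<close> and are not interior, so none of them comes from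
  \<open>B\<close>.\<close>

lemma convex_hull_Un_eq_if_subset_interior:
  fixes A B :: "'a::euclidean_space set"
  assumes "finite A" "finite B" "B \<subseteq> interior (convex hull (A \<union> B))"
  shows "convex hull (A \<union> B) = convex hull A"
proof
  let ?H = "convex hull (A \<union> B)"
  have "compact ?H"
    using assms by (intro finite_imp_compact_convex_hull) auto
  then have "?H = convex hull {x. x extreme_point_of ?H}"
    by (intro Krein_Milman_Minkowski) auto
  moreover have "{x. x extreme_point_of ?H} \<subseteq> A"
    using assms(3) extreme_point_of_convex_hull extreme_point_not_in_interior by fastforce
  ultimately show "?H \<subseteq> convex hull A"
    by (metis hull_mono)
qed (simp add: hull_mono)

text \<open>This decouples the points: on the right the hull no longer depends on \<open>B\<close>,
  so for fixed \<open>A\<close> the condition is imposed on each point of \<open>B\<close>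
  separately.\<close>

lemma subset_interior_convex_hull_Un_iff:
  fixes A B :: "'a::euclidean_space set"
  assumes "finite A" "finite B"
  shows "B \<subseteq> interior (convex hull (A \<union> B)) \<longleftrightarrow> B \<subseteq> interior (convex hull A)"
  using convex_hull_Un_eq_if_subset_interior[OF assms]
    interior_mono[OF hull_mono[of A "A \<union> B" convex]] by fastforce

text \<open>Only countably many conditions occur on the right, which yields joint measurability in
  the point and the configuration.\<close>

lemma mem_interior_convex_hull_iff_dense:
  fixes S D :: "'a::euclidean_space set"
  assumes S: "finite S"
    and D: "\<And>X. open X \<Longrightarrow> X \<noteq> {} \<Longrightarrow> \<exists>d\<in>D. d \<in> X"
  shows "x \<in> interior (convex hull S) \<longleftrightarrow>
    (\<exists>n. \<forall>u\<in>D - {0}. \<exists>y\<in>S. u \<bullet> x + norm u / real (Suc n) < u \<bullet> y)"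
proof
  assume "x \<in> interior (convex hull S)"
  then obtain e where e: "e > 0" "ball x e \<subseteq> convex hull S"
    by (meson mem_interior)
  obtain n where n: "inverse (real (Suc n)) < e / 2"
    using reals_Archimedean[of "e / 2"] e by auto
  have "\<exists>y\<in>S. u \<bullet> x + norm u / real (Suc n) < u \<bullet> y" if "u \<in> D - {0}" for u
  proof (rule ccontr)
    assume "\<not> ?thesis"
    then have "S \<subseteq> {y. u \<bullet> y \<le> u \<bullet> x + norm u / real (Suc n)}"
      by (auto simp: not_less)
    then have sub: "convex hull S \<subseteq> {y. u \<bullet> y \<le> u \<bullet> x + norm u / real (Suc n)}"
      by (intro hull_minimal convex_halfspace_le)
    have pos: "norm u > 0" using that by simp
    \<comment> \<open>The point at distance \<open>e / 2\<close> from \<open>x\<close> in direction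
      \<open>u\<close> is still in the ball, but lies beyond the halfspace because
      \<open>1 / Suc n < e / 2\<close>.\<close>
    define z where "z = x + (e / 2 / norm u) *\<^sub>R u"
    have "dist x z < e"
      using e pos by (simp add: z_def dist_norm)
    then have "z \<in> convex hull S" using e by auto
    then have "u \<bullet> z \<le> u \<bullet> x + norm u / real (Suc n)" using sub by auto
    moreover have "u \<bullet> z = u \<bullet> x + e / 2 * norm u"
      using pos by (simp add: z_def inner_add_right dot_square_norm power2_eq_square)
    ultimately have "e / 2 * norm u \<le> inverse (real (Suc n)) * norm u"
      by (simp add: field_simps)
    then show False using n pos by simp
  qed
  then show "\<exists>n. \<forall>u\<in>D - {0}. \<exists>y\<in>S. u \<bullet> x + norm u / real (Suc n) < u \<bullet> y"
    by blast
next
  assume "\<exists>n. \<forall>u\<in>D - {0}. \<exists>y\<in>S. u \<bullet> x + norm u / real (Suc n) < u \<bullet> y"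
  then obtain n where n: "\<And>u. u \<in> D - {0} \<Longrightarrow> \<exists>y\<in>S. u \<bullet> x + norm u / real (Suc n) < u \<bullet> y"
    by blast
  \<comment> \<open>A dense set contains a nonzero direction, for which \<open>n\<close> supplies a
    point of \<open>S\<close>. That \<open>S\<close> is nonempty later excludes
    \<open>u = 0\<close>.\<close>
  obtain b :: 'a where "b \<in> Basis" using nonempty_Basis by blast
  then have "- {0::'a} \<noteq> {}" by (auto dest: nonzero_Basis)
  then have "\<exists>d\<in>D. d \<in> - {0::'a}" by (intro D) auto
  then have ne: "S \<noteq> {}" using n by fastforce
  have "ball x (1 / real (Suc n)) \<subseteq> convex hull S"
  proof (rule ccontr)
    assume "\<not> ?thesis"
    then obtain z where z: "dist x z < 1 / real (Suc n)" "z \<notin> convex hull S"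
      unfolding subset_iff mem_ball by blast
    have "closed (convex hull S)"
      using S by (intro compact_imp_closed finite_imp_compact_convex_hull)
    then obtain a b where ab: "a \<bullet> z < b" "\<forall>y\<in>convex hull S. b < a \<bullet> y"
      using separating_hyperplane_closed_point[of "convex hull S" z] z by auto
    \<comment> \<open>\<open>X\<close> collects the directions in which \<open>z\<close> strictly
      exceeds all of \<open>S\<close>. Finiteness of \<open>S\<close> makes it open, so the
      separating direction \<open>- a\<close> can be replaced by one from \<open>D\<close>.\<close>
    define X where "X = (\<Inter>y\<in>S. {u. u \<bullet> y < u \<bullet> z})"
    have "open X"
      unfolding X_def using S by (intro open_INT ballI open_Collect_less continuous_intros)
    moreover have "- a \<in> X"
      using ab hull_subset[of S convex] by (fastforce simp: X_def)
    ultimately obtain u where u: "u \<in> D" "u \<in> X" using D by blast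
    have "u \<noteq> 0" using u ne by (auto simp: X_def)
    then obtain y where y: "y \<in> S" "u \<bullet> x + norm u / real (Suc n) < u \<bullet> y"
      using n[of u] u by auto
    then have "norm u / real (Suc n) < u \<bullet> (z - x)"
      using u by (fastforce simp: X_def inner_diff_right)
    also have "\<dots> \<le> norm u * norm (z - x)" by (rule norm_cauchy_schwarz)
    also have "\<dots> \<le> norm u * (1 / real (Suc n))"
      using z by (intro mult_left_mono) (auto simp: dist_norm norm_minus_commute)
    finally show False by simp
  qed
  then show "x \<in> interior (convex hull S)"
    by (subst mem_interior) (auto intro!: exI[of _ "1 / real (Suc n)"])
qed

subsection \<open>The space of finite point configurations\<close>

text \<open>Generating by the avoidance events instead of all counting events gives a
  \<open>\<inter>\<close>-stable generator, because avoiding A and B means avoiding their union.\<close>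

definition fset_algebra :: "'a::topological_space set measure" where
  "fset_algebra = sigma {S. finite S} ((\<lambda>A. {S. finite S \<and> S \<inter> A = {}}) ` sets borel)"

lemma space_fset_algebra [simp]: "space fset_algebra = {S. finite S}"
  unfolding fset_algebra_def by (subst space_measure_of) auto

lemma sets_fset_algebra:
  "sets fset_algebra = sigma_sets {S. finite S} ((\<lambda>A. {S. finite S \<and> S \<inter> A = {}}) ` sets borel)"
  unfolding fset_algebra_def by (subst sets_measure_of) auto

lemma avoid_in_sets_fset_algebra:
  "A \<in> sets borel \<Longrightarrow> {S. finite S \<and> S \<inter> A = {}} \<in> sets fset_algebra"
  unfolding sets_fset_algebra by (intro sigma_sets.Basic) auto

lemma hit_in_sets_fset_algebra:
  assumes "A \<in> sets borel"
  shows "{S. finite S \<and> S \<inter> A \<noteq> {}} \<in> sets fset_algebra"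
proof -
  have "{S. finite S \<and> S \<inter> A \<noteq> {}} = space fset_algebra - {S. finite S \<and> S \<inter> A = {}}"
    by auto
  then show ?thesis
    using sets.compl_sets[OF avoid_in_sets_fset_algebra[OF assms]] by simp
qed

lemma Int_stable_avoid: "Int_stable ((\<lambda>A. {S. finite S \<and> S \<inter> A = {}}) ` sets borel)"
proof (intro Int_stableI_image)
  fix A B :: "'a set" assume "A \<in> sets borel" "B \<in> sets borel"
  then show "\<exists>C\<in>sets borel. {S. finite S \<and> S \<inter> A = {}} \<inter> {S. finite S \<and> S \<inter> B = {}}
      = {S. finite S \<and> S \<inter> C = {}}"
    by (intro bexI[of _ "A \<union> B"]) auto
qed

lemma measurable_into_fset_algebra:
  fixes f :: "'w \<Rightarrow> 'a::topological_space set"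
  assumes "\<And>\<omega>. \<omega> \<in> space M \<Longrightarrow> finite (f \<omega>)"
    and "\<And>A. A \<in> sets borel \<Longrightarrow> {\<omega> \<in> space M. f \<omega> \<inter> A = {}} \<in> sets M"
  shows "f \<in> measurable M fset_algebra"
  unfolding fset_algebra_def
proof (rule measurable_measure_of)
  fix Y :: "'a set set" assume "Y \<in> (\<lambda>A. {S. finite S \<and> S \<inter> A = {}}) ` sets borel"
  then obtain A where A: "A \<in> sets borel" "Y = {S. finite S \<and> S \<inter> A = {}}" by auto
  then have "f -` Y \<inter> space M = {\<omega> \<in> space M. f \<omega> \<inter> A = {}}"
    using assms(1) by auto
  then show "f -` Y \<inter> space M \<in> sets M" using assms(2) A by simp
qed (use assms(1) in auto)

section \<open>Measurability of counts and of the interior relation\<close>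

lemma finite_separating_basis:
  fixes T :: "'a::metric_space set"
  assumes B: "topological_basis B" and T: "finite T"
  obtains U where "\<And>x. x \<in> T \<Longrightarrow> U x \<in> B" "\<And>x. x \<in> T \<Longrightarrow> x \<in> U x" "disjoint_family_on U T"
proof -
  define E where "E = (\<lambda>(x, y). dist x y) ` (T \<times> T - Id)"
  \<comment> \<open>The inserted 1 keeps the minimum defined and positive when \<open>T\<close> has
    fewer than two points.\<close>
  define e where "e = Min (insert 1 E)"
  have fin: "finite E" using T by (simp add: E_def)
  then have e: "e > 0" unfolding e_def by (subst Min_gr_iff) (auto simp: E_def)
  have dist: "e \<le> dist x y" if "x \<in> T" "y \<in> T" "x \<noteq> y" for x y
    unfolding e_def using fin that by (intro Min_le) (auto simp: E_def)
  have "\<exists>V\<in>B. x \<in> V \<and> V \<subseteq> ball x (e / 2)" for x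
    using topological_basisE[OF B, of "ball x (e / 2)" x] e
    by (metis centre_in_ball half_gt_zero open_ball)
  then obtain U where U: "\<And>x. U x \<in> B" "\<And>x. x \<in> U x" "\<And>x. U x \<subseteq> ball x (e / 2)"
    by metis
  have "disjoint_family_on U T"
    unfolding disjoint_family_on_def
  proof (intro ballI impI)
    fix x y assume xy: "x \<in> T" "y \<in> T" "x \<noteq> y"
    have "dist x y < e" if "z \<in> U x" "z \<in> U y" for z
      using U(3)[of x] U(3)[of y] that
      by (metis dist_commute dist_triangle_half_r mem_ball subsetD)
    then show "U x \<inter> U y = {}" using dist[OF xy] by fastforce
  qed
  with U show ?thesis by (intro that) auto
qed

text \<open>Distinct points of \<open>T\<close> lie in disjoint basis sets; conversely, disjoint
  sets are hit in distinct points. This expresses a count through hitting events alone.\<close>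

lemma card_ge_iff_disjoint_basis_hits:
  fixes T :: "'a::metric_space set"
  assumes B: "topological_basis B" and T: "finite T"
  shows "m \<le> card T \<longleftrightarrow>
    (\<exists>F. finite F \<and> F \<subseteq> B \<and> disjoint F \<and> card F = m \<and> (\<forall>V\<in>F. T \<inter> V \<noteq> {}))"
proof
  assume "m \<le> card T"
  then obtain T' where T': "T' \<subseteq> T" "card T' = m"
    by (meson obtain_subset_with_card_n)
  obtain U where U: "\<And>x. x \<in> T' \<Longrightarrow> U x \<in> B" "\<And>x. x \<in> T' \<Longrightarrow> x \<in> U x" "disjoint_family_on U T'"
    using finite_separating_basis[OF B, of T'] T T' finite_subset by metis
  have "inj_on U T'"
    using U(2,3) by (fastforce simp: inj_on_def disjoint_family_on_def)
  then have "card (U ` T') = m" using T' by (simp add: card_image)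
  moreover have "disjoint (U ` T')"
    using U(3) by (rule disjoint_family_on_disjoint_image)
  ultimately show "\<exists>F. finite F \<and> F \<subseteq> B \<and> disjoint F \<and> card F = m \<and> (\<forall>V\<in>F. T \<inter> V \<noteq> {})"
    using U T' T by (intro exI[of _ "U ` T'"]) (auto intro: finite_subset)
next
  assume "\<exists>F. finite F \<and> F \<subseteq> B \<and> disjoint F \<and> card F = m \<and> (\<forall>V\<in>F. T \<inter> V \<noteq> {})"
  then obtain F where F: "finite F" "disjoint F" "card F = m" "\<And>V. V \<in> F \<Longrightarrow> T \<inter> V \<noteq> {}"
    by blast
  then obtain g where g: "\<And>V. V \<in> F \<Longrightarrow> g V \<in> T \<inter> V" by (meson all_not_in_conv)
  have "inj_on g F"
  proof (rule inj_onI)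
    fix V V' assume V: "V \<in> F" "V' \<in> F" "g V = g V'"
    then have "g V \<in> V \<inter> V'" using g[of V] g[of V'] by simp
    then show "V = V'" using F(2) V by (auto simp: disjoint_def)
  qed
  then show "m \<le> card T"
    using card_inj_on_le[of g F T] g F T by auto
qed

text \<open>Counting events are recovered from avoidance events: having at least \<open>m\<close>
  points in \<open>A\<close> is a countable union, over finite disjoint families of basis sets, of
  finitely many hitting conditions.\<close>

lemma measurable_card_Int_fset_algebra:
  fixes A :: "'a::{metric_space, second_countable_topology} set"
  assumes A: "A \<in> sets borel"
  shows "(\<lambda>S. card (S \<inter> A)) \<in> measurable fset_algebra (count_space UNIV)"
proof -
  obtain B :: "'a set set" where B: "countable B" "topological_basis B"
    using ex_countable_basis by blast
  have ge: "{S. finite S \<and> m \<le> card (S \<inter> A)} \<in> sets fset_algebra" for m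
  proof -
    define \<F> where "\<F> = {F. finite F \<and> F \<subseteq> B} \<inter> {F. disjoint F \<and> card F = m}"
    have "countable \<F>"
      unfolding \<F>_def using B by (intro countable_Int1 countable_Collect_finite_subset)
    have "{S. finite S \<and> m \<le> card (S \<inter> A)} =
        (\<Union>F\<in>\<F>. {S\<in>space fset_algebra. \<forall>V\<in>F. S \<in> {S. finite S \<and> S \<inter> (A \<inter> V) \<noteq> {}}})"
    proof (intro set_eqI)
      fix S :: "'a set"
      show "S \<in> {S. finite S \<and> m \<le> card (S \<inter> A)} \<longleftrightarrow> S \<in> (\<Union>F\<in>\<F>.
          {S\<in>space fset_algebra. \<forall>V\<in>F. S \<in> {S. finite S \<and> S \<inter> (A \<inter> V) \<noteq> {}}})"
        using card_ge_iff_disjoint_basis_hits[OF B(2), of "S \<inter> A" m]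
        unfolding \<F>_def UN_iff Bex_def mem_Collect_eq Int_iff Int_assoc space_fset_algebra
        by (metis finite_Int)
    qed
    also have "\<dots> \<in> sets fset_algebra"
    proof (intro sets.countable_UN' \<open>countable \<F>\<close> image_subsetI sets.sets_Collect_finite_All)
      fix F V assume "F \<in> \<F>" "V \<in> F"
      then have "A \<inter> V \<in> sets borel"
        using topological_basis_open[OF B(2)] by (intro sets.Int[OF A] borel_open) (auto simp: \<F>_def)
      from hit_in_sets_fset_algebra[OF this]
      show "{S \<in> space fset_algebra. S \<in> {S. finite S \<and> S \<inter> (A \<inter> V) \<noteq> {}}} \<in> sets fset_algebra"
        by (simp add: Collect_conj_eq[symmetric] cong: conj_cong)
    qed (auto simp: \<F>_def)
    finally show ?thesis .
  qed
  have "(\<lambda>S. card (S \<inter> A)) -` {m} \<inter> space fset_algebra =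
      {S. finite S \<and> m \<le> card (S \<inter> A)} - {S. finite S \<and> Suc m \<le> card (S \<inter> A)}" for m
    by auto
  then show ?thesis
    using ge by (auto simp: measurable_count_space_eq2_countable)
qed

text \<open>A Dynkin argument over \<open>G\<close>: a rectangle gives a count times an indicator, a
  complement gives the difference from the total count, and a disjoint union gives a series. It
  serves to count the points of a configuration whose property depends on the whole
  configuration.\<close>

lemma borel_measurable_sum_points:
  fixes G :: "('a::{metric_space, second_countable_topology} \<times> 'a set) set"
  assumes "G \<in> sets (borel \<Otimes>\<^sub>M fset_algebra)"
  shows "(\<lambda>S. \<Sum>x\<in>S. indicator G (x, S) :: ennreal) \<in> borel_measurable fset_algebra"
  using Int_stable_pair_measure_generator pair_measure_closed assms
  unfolding sets_pair_measure
proof (induct rule: sigma_sets_induct_disjoint)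
  case (basic R)
  then obtain A B where AB: "A \<in> sets borel" "B \<in> sets fset_algebra" "R = A \<times> B" by auto
  note [measurable] = measurable_card_Int_fset_algebra[OF AB(1)] AB(2)
  have "(\<lambda>S. of_nat (card (S \<inter> A)) * indicator B S :: ennreal) \<in> borel_measurable fset_algebra"
    by measurable
  moreover have "(\<Sum>x\<in>S. indicator R (x, S)) = (of_nat (card (S \<inter> A)) * indicator B S :: ennreal)"
    if "S \<in> space fset_algebra" for S
  proof -
    have "(\<Sum>x\<in>S. indicator R (x, S) :: ennreal) = (\<Sum>x\<in>S. indicator A x * indicator B S)"
      by (intro sum.cong) (auto simp: AB indicator_def)
    also have "\<dots> = (\<Sum>x\<in>S. indicator A x) * indicator B S"
      by (simp add: sum_distrib_right)
    also have "(\<Sum>x\<in>S. indicator A x :: ennreal) = of_nat (card (S \<inter> A))"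
      using that by (simp add: indicator_def sum.If_cases)
    finally show ?thesis .
  qed
  ultimately show ?case by (subst measurable_cong) auto
next
  case (compl R)
  note [measurable] = compl(2) measurable_card_Int_fset_algebra[of UNIV, simplified]
  have "(\<lambda>S. of_nat (card S) - (\<Sum>x\<in>S. indicator R (x, S)) :: ennreal) \<in> borel_measurable fset_algebra"
    by measurable
  moreover have "(\<Sum>x\<in>S. indicator (space borel \<times> space fset_algebra - R) (x, S))
      = (of_nat (card S) - (\<Sum>x\<in>S. indicator R (x, S)) :: ennreal)"
    if S: "S \<in> space fset_algebra" for S
  proof -
    have "(\<Sum>x\<in>S. indicator (space borel \<times> space fset_algebra - R) (x, S)) + (\<Sum>x\<in>S. indicator R (x, S))
        = (\<Sum>x\<in>S. 1 :: ennreal)"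
      unfolding sum.distrib[symmetric] using S by (intro sum.cong) (auto simp: indicator_def)
    \<comment> \<open>Cancellation in \<open>ennreal\<close> requires the subtracted sum to be
      finite.\<close>
    moreover have "(\<Sum>x\<in>S. indicator R (x, S) :: ennreal) \<noteq> top"
      using S by (simp add: ennreal_sum_less_top less_top[symmetric] indicator_def)
    ultimately show ?thesis by (metis ennreal_add_diff_cancel_right sum_constant mult.right_neutral)
  qed
  ultimately show ?case by (subst measurable_cong) auto
next
  case (union R)
  have "(\<Sum>x\<in>S. indicator (\<Union>i. R i) (x, S)) = (\<Sum>i. \<Sum>x\<in>S. indicator (R i) (x, S) :: ennreal)" for S
    using suminf_indicator[OF union(1)] by (subst suminf_sum) auto
  then show ?case using union(3) by simp
next
  case empty
  show ?case by simp
qed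

text \<open>The dense-direction criterion turns the relation into a countable union of countable
  intersections of the sets \<open>W\<close>.\<close>

lemma interior_convex_hull_in_sets_pair:
  "{(x, S). finite S \<and> x \<in> interior (convex hull S)}
    \<in> sets (borel \<Otimes>\<^sub>M (fset_algebra :: 'a::euclidean_space set measure))"
proof -
  obtain D :: "'a set" where D: "countable D" "\<And>X. open X \<Longrightarrow> X \<noteq> {} \<Longrightarrow> \<exists>d\<in>D. d \<in> X"
    by (rule countable_dense_setE) auto
  define W :: "real \<Rightarrow> 'a \<Rightarrow> ('a \<times> 'a set) set" where
    "W c u = {(x, S). finite S \<and> (\<exists>y\<in>S. u \<bullet> x + c < u \<bullet> y)}" for c u
  have W: "W c u \<in> sets (borel \<Otimes>\<^sub>M fset_algebra)" for c u
  proof -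
    \<comment> \<open>A rational \<open>q\<close> strictly between the two sides separates the
      condition on \<open>x\<close> from the one on \<open>S\<close>, leaving a countable union of
      measurable rectangles.\<close>
    have "W c u = (\<Union>q\<in>\<rat>. {x. u \<bullet> x + c < q} \<times> {S. finite S \<and> S \<inter> {y. q < u \<bullet> y} \<noteq> {}})"
      unfolding W_def using Rats_dense_in_real by (fastforce intro: less_trans)
    also have "\<dots> \<in> sets (borel \<Otimes>\<^sub>M fset_algebra)"
      by (intro sets.countable_UN' countable_rat image_subsetI pair_measureI hit_in_sets_fset_algebra borel_open
          open_Collect_less continuous_intros)
    finally show ?thesis .
  qed
  \<comment> \<open>The intersection below must run over a nonempty index set; membership in some
    \<open>W\<close> also yields finiteness of \<open>S\<close>.\<close>
  obtain b :: 'a where "b \<in> Basis" using nonempty_Basis by blast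
  then have "- {0::'a} \<noteq> {}" by (auto dest: nonzero_Basis)
  then have ne: "D - {0} \<noteq> {}" using D(2)[of "- {0}"] by auto
  have "{(x, S). finite S \<and> x \<in> interior (convex hull S)} =
      (\<Union>n. \<Inter>u\<in>D - {0}. W (norm u / real (Suc n)) u)" (is "?L = ?R")
  proof (intro set_eqI)
    fix p :: "'a \<times> 'a set"
    show "p \<in> ?L \<longleftrightarrow> p \<in> ?R"
      using mem_interior_convex_hull_iff_dense[OF _ D(2), of "snd p" "fst p"] ne
      unfolding W_def UN_iff INT_iff mem_Collect_eq case_prod_unfold by blast
  qed
  also have "\<dots> \<in> sets (borel \<Otimes>\<^sub>M fset_algebra)"
    using D(1) W ne by (intro sets.countable_UN' sets.countable_INT' image_subsetI) auto
  finally show ?thesis .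
qed

subsection \<open>Poisson processes as mixtures of i.i.d. samples\<close>

lemma measurable_image_fset_algebra:
  fixes mu :: "'a::topological_space measure"
  assumes "finite I" and sets: "sets mu = sets borel"
  shows "(\<lambda>x. x ` I) \<in> measurable (\<Pi>\<^sub>M i\<in>I. mu) fset_algebra"
proof (rule measurable_into_fset_algebra)
  fix A :: "'a set" assume A: "A \<in> sets borel"
  have "{x \<in> space (\<Pi>\<^sub>M i\<in>I. mu). x ` I \<inter> A = {}} = (\<Pi>\<^sub>E i\<in>I. - A)"
    using sets_eq_imp_space_eq[OF sets] by (auto simp: space_PiM PiE_iff extensional_def)
  also have "\<dots> \<in> sets (\<Pi>\<^sub>M i\<in>I. mu)"
    using A assms by (intro sets_PiM_I_finite) auto
  finally show "{x \<in> space (\<Pi>\<^sub>M i\<in>I. mu). x ` I \<inter> A = {}} \<in> sets (\<Pi>\<^sub>M i\<in>I. mu)" .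
qed (use assms in auto)

text \<open>Taking the image forgets the order and merges coinciding points, so a configuration may
  have fewer than \<open>n\<close> elements. As a function of \<open>n\<close> this is the kernel to
  be mixed with Poisson weights.\<close>

definition iid_points :: "'a::topological_space measure \<Rightarrow> nat \<Rightarrow> 'a set measure" where
  "iid_points mu n = distr (\<Pi>\<^sub>M i\<in>{..<n}. mu) fset_algebra (\<lambda>x. x ` {..<n})"

lemma sets_iid_points [simp]: "sets (iid_points mu n) = sets fset_algebra"
  by (simp add: iid_points_def)

lemma prob_space_iid_points:
  assumes "prob_space mu" "sets mu = sets borel"
  shows "prob_space (iid_points mu n)"
  unfolding iid_points_def using assms
  by (intro prob_space.prob_space_distr prob_space_PiM measurable_image_fset_algebra) auto

lemma measurable_iid_points:
  assumes "prob_space mu" "sets mu = sets borel"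
  shows "iid_points mu \<in> measurable (measure_pmf p) (subprob_algebra fset_algebra)"
  using prob_space_iid_points[OF assms]
  by (auto simp: space_subprob_algebra intro!: prob_space_imp_subprob_space)

lemma nn_integral_iid_points:
  assumes "sets mu = sets borel" "f \<in> borel_measurable fset_algebra"
  shows "(\<integral>\<^sup>+ S. f S \<partial>iid_points mu n) = (\<integral>\<^sup>+ x. f (x ` {..<n}) \<partial>(\<Pi>\<^sub>M i\<in>{..<n}. mu))"
  unfolding iid_points_def using assms
  by (intro nn_integral_distr measurable_image_fset_algebra) auto

lemma emeasure_iid_points_avoid:
  fixes A :: "'a::topological_space set"
  assumes "prob_space mu" "sets mu = sets borel" "A \<in> sets borel"
  shows "emeasure (iid_points mu n) {S. finite S \<and> S \<inter> A = {}} = ennreal ((1 - measure mu A) ^ n)"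
proof -
  interpret prob_space mu by fact
  interpret product_sigma_finite "\<lambda>_::nat. mu"
    by unfold_locales
  have space: "space mu = UNIV" using sets_eq_imp_space_eq[OF assms(2)] by simp
  have "emeasure (iid_points mu n) {S. finite S \<and> S \<inter> A = {}} =
      emeasure (\<Pi>\<^sub>M i\<in>{..<n}. mu) ((\<lambda>x. x ` {..<n}) -` {S. finite S \<and> S \<inter> A = {}} \<inter> space (\<Pi>\<^sub>M i\<in>{..<n}. mu))"
    unfolding iid_points_def
    by (intro emeasure_distr measurable_image_fset_algebra avoid_in_sets_fset_algebra assms) auto
  also have "(\<lambda>x. x ` {..<n}) -` {S. finite S \<and> S \<inter> A = {}} \<inter> space (\<Pi>\<^sub>M i\<in>{..<n}. mu)
      = (\<Pi>\<^sub>E i\<in>{..<n}. - A)"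
    using space by (auto simp: space_PiM PiE_iff extensional_def)
  also have "emeasure (\<Pi>\<^sub>M i\<in>{..<n}. mu) \<dots> = (\<Prod>i<n. emeasure mu (- A))"
    using assms by (intro emeasure_PiM) auto
  also have "emeasure mu (- A) = ennreal (1 - measure mu A)"
    using prob_compl[of A] assms space by (simp add: emeasure_eq_measure Compl_eq_Diff_UNIV)
  finally show ?thesis by (simp add: ennreal_power)
qed

text \<open>The avoidance events form a generator stable under intersections, so it suffices to
  compare avoidance probabilities. Both equal \<open>exp (- (t * measure mu A))\<close>.\<close>

lemma distr_poisson_process:
  fixes eta :: "'w \<Rightarrow> 'a::euclidean_space set"
  assumes mu: "prob_space mu" "sets mu = sets borel" and "t > 0"
    and PP: "poisson_process M eta mu t"
  shows "eta \<in> measurable M fset_algebra"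
    and "distr M fset_algebra eta = measure_pmf (poisson_pmf t) \<bind> iid_points mu"
proof -
  interpret M: prob_space M using PP by (simp add: poisson_process_def)
  have fin: "\<And>\<omega>. \<omega> \<in> space M \<Longrightarrow> finite (eta \<omega>)"
    and meas: "\<And>A. A \<in> sets borel \<Longrightarrow> (\<lambda>\<omega>. card (eta \<omega> \<inter> A)) \<in> measurable M (count_space UNIV)"
    and count: "\<And>A n. A \<in> sets borel \<Longrightarrow> measure M {\<omega>\<in>space M. card (eta \<omega> \<inter> A) = n}
             = exp (- (t * measure mu A)) * (t * measure mu A) ^ n / fact n"
    using PP by (auto simp: poisson_process_def)
  have avoid: "{\<omega> \<in> space M. eta \<omega> \<inter> A = {}} = {\<omega>\<in>space M. card (eta \<omega> \<inter> A) = 0}" for A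
    using fin by auto
  show eta: "eta \<in> measurable M fset_algebra"
  proof (rule measurable_into_fset_algebra)
    fix A :: "'a set" assume "A \<in> sets borel"
    note [measurable] = meas[OF this]
    show "{\<omega> \<in> space M. eta \<omega> \<inter> A = {}} \<in> sets M"
      unfolding avoid by measurable
  qed (rule fin)
  let ?Q = "measure_pmf (poisson_pmf t) \<bind> iid_points mu"
  note K = measurable_iid_points[OF mu]
  let ?E = "(\<lambda>A. {S. finite S \<and> S \<inter> A = {}}) ` sets (borel :: 'a measure)"
  show "distr M fset_algebra eta = ?Q"
  proof (rule measure_eqI_generator_eq[OF Int_stable_avoid, where \<Omega> = "{S. finite S}"])
    fix X :: "'a set set" assume "X \<in> ?E"
    then obtain A where A: "A \<in> sets borel" and X: "X = {S. finite S \<and> S \<inter> A = {}}" by auto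
    have Xs: "X \<in> sets fset_algebra" unfolding X using A by (rule avoid_in_sets_fset_algebra)
    have "emeasure (distr M fset_algebra eta) X = emeasure M {\<omega> \<in> space M. eta \<omega> \<inter> A = {}}"
      unfolding emeasure_distr[OF eta Xs] using fin by (auto simp: X intro!: arg_cong[where f = "emeasure M"])
    also have "\<dots> = ennreal (exp (- (t * measure mu A)))"
      unfolding avoid M.emeasure_eq_measure using count[OF A, of 0] by simp
    also have "\<dots> = emeasure ?Q X"
    proof -
      \<comment> \<open>\<open>p\<close> is the probability that one sample point misses
        \<open>A\<close>; averaging \<open>p ^ n\<close> gives the generating function of the
        Poisson distribution at \<open>p\<close>.\<close>
      define p where "p = 1 - measure mu A"
      have p: "0 \<le> p" using prob_space.prob_le_1[OF mu(1), of A] by (simp add: p_def)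
      have "emeasure ?Q X = (\<integral>\<^sup>+ n. emeasure (iid_points mu n) X \<partial>measure_pmf (poisson_pmf t))"
        by (rule emeasure_bind[OF _ K Xs]) simp
      also have "\<dots> = (\<integral>\<^sup>+ n. ennreal (p ^ n) \<partial>measure_pmf (poisson_pmf t))"
        by (simp add: emeasure_iid_points_avoid[OF mu A] X p_def)
      also have "\<dots> = (\<Sum>n. ennreal (t ^ n / fact n * exp (- t)) * ennreal (p ^ n))"
        using \<open>t > 0\<close> by (simp add: nn_integral_measure_pmf nn_integral_count_space_nat)
      also have "\<dots> = (\<Sum>n. ennreal (exp (- t) * ((t * p) ^ n / fact n)))"
        using \<open>t > 0\<close> p by (intro suminf_cong) (simp add: ennreal_mult'[symmetric] power_mult_distrib mult_ac)
      also have "\<dots> = ennreal (exp (- t) * exp (t * p))"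
      proof (rule suminf_ennreal_eq)
        show "(\<lambda>n. exp (- t) * ((t * p) ^ n / fact n)) sums (exp (- t) * exp (t * p))"
          using exp_converges[of "t * p"] by (intro sums_mult) (simp add: divide_inverse mult_ac)
      qed (use \<open>t > 0\<close> p in auto)
      also have "exp (- t) * exp (t * p) = exp (- (t * measure mu A))"
        by (simp add: exp_add[symmetric] p_def algebra_simps)
      finally show ?thesis by simp
    qed
    finally show "emeasure (distr M fset_algebra eta) X = emeasure ?Q X" .
  next
    show "sets ?Q = sigma_sets {S. finite S} ?E"
      by (subst sets_bind[where N = fset_algebra]) (auto simp: sets_fset_algebra)
    \<comment> \<open>Avoiding the empty set is no restriction, so the whole space is itself in the
      generator.\<close>
    show "range (\<lambda>_::nat. {S. finite S}) \<subseteq> ?E"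
      by (auto intro!: image_eqI[of _ _ "{}"])
    show "emeasure (distr M fset_algebra eta) {S. finite S} \<noteq> \<infinity>"
      using prob_space.emeasure_space_1[OF M.prob_space_distr[OF eta]] by simp
  qed (auto simp: sets_fset_algebra)
qed

text \<open>Conditioning on the sample size turns both expectations in the theorem into
  Poisson-weighted series of integrals over finite products.\<close>

lemma nn_integral_poisson_process:
  fixes eta :: "'w \<Rightarrow> 'a::euclidean_space set"
  assumes mu: "prob_space mu" "sets mu = sets borel" and "t > 0"
    and PP: "poisson_process M eta mu t" and f: "f \<in> borel_measurable fset_algebra"
  shows "(\<integral>\<^sup>+ \<omega>. f (eta \<omega>) \<partial>M) =
    (\<Sum>n. ennreal (t ^ n / fact n * exp (- t)) * (\<integral>\<^sup>+ x. f (x ` {..<n}) \<partial>(\<Pi>\<^sub>M i\<in>{..<n}. mu)))"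
proof -
  note K = measurable_iid_points[OF mu]
  have "(\<integral>\<^sup>+ \<omega>. f (eta \<omega>) \<partial>M) = (\<integral>\<^sup>+ S. f S \<partial>distr M fset_algebra eta)"
    using distr_poisson_process(1)[OF mu \<open>t > 0\<close> PP] f by (simp add: nn_integral_distr)
  also have "\<dots> = (\<integral>\<^sup>+ n. \<integral>\<^sup>+ S. f S \<partial>iid_points mu n \<partial>measure_pmf (poisson_pmf t))"
    unfolding distr_poisson_process(2)[OF mu \<open>t > 0\<close> PP] by (rule nn_integral_bind[OF f K])
  also have "\<dots> = (\<Sum>n. ennreal (t ^ n / fact n * exp (- t)) *
      (\<integral>\<^sup>+ x. f (x ` {..<n}) \<partial>(\<Pi>\<^sub>M i\<in>{..<n}. mu)))"
    using \<open>t > 0\<close>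
    by (simp add: nn_integral_measure_pmf nn_integral_count_space_nat nn_integral_iid_points[OF mu(2) f])
  finally show ?thesis .
qed

subsection \<open>Interior points of the convex hull of a sample\<close>

text \<open>The frontier of a convex set is Lebesgue-null, hence null for \<open>mu\<close> by
  absolute continuity; the hull is closed, so it is the union of its interior and its
  frontier.\<close>

lemma emeasure_interior_convex_hull:
  fixes S :: "'a::euclidean_space set"
  assumes ac: "absolutely_continuous lborel mu" and sets: "sets mu = sets borel" and S: "finite S"
  shows "emeasure mu (interior (convex hull S)) = emeasure mu (convex hull S)"
proof -
  have cl: "closed (convex hull S)"
    using S by (intro compact_imp_closed finite_imp_compact_convex_hull)
  have fr: "frontier (convex hull S) \<in> sets borel" by (intro borel_closed frontier_closed)
  have "frontier (convex hull S) \<in> null_sets lborel"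
    using negligible_convex_frontier[of "convex hull S"] fr
    by (auto simp: negligible_iff_null_sets null_sets_completion_iff)
  then have "frontier (convex hull S) \<in> null_sets mu"
    using ac by (auto simp: absolutely_continuous_def)
  then have "emeasure mu (interior (convex hull S) \<union> frontier (convex hull S)) = emeasure mu (interior (convex hull S))"
    using sets by (intro emeasure_Un_null_set) auto
  moreover have "interior (convex hull S) \<union> frontier (convex hull S) = convex hull S"
    using cl interior_subset[of "convex hull S"] by (auto simp: frontier_def)
  ultimately show ?thesis by simp
qed

text \<open>Replacing the hull by its interior, which has the same measure, makes this the measure
  of a section of the measurable set of pairs.\<close>

lemma measurable_measure_convex_hull:
  fixes mu :: "'a::euclidean_space measure"
  assumes "prob_space mu" "absolutely_continuous lborel mu" and sets: "sets mu = sets borel"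
  shows "(\<lambda>S. ennreal (measure mu (convex hull S) ^ k)) \<in> borel_measurable fset_algebra"
proof -
  interpret prob_space mu by fact
  have "{(x, S). finite S \<and> x \<in> interior (convex hull S)} \<in> sets (mu \<Otimes>\<^sub>M fset_algebra)"
    using interior_convex_hull_in_sets_pair by (simp add: sets cong: sets_pair_measure_cong)
  \<comment> \<open>The swap puts the configuration first, where
    \<open>measurable_emeasure_Pair\<close> fixes the coordinate.\<close>
  from measurable_sets[OF measurable_pair_swap' this]
  have "(\<lambda>S. emeasure mu (Pair S -` ((\<lambda>(x, y). (y, x)) -` {(x, S). finite S \<and> x \<in> interior (convex hull S)} \<inter>
      space (fset_algebra \<Otimes>\<^sub>M mu)))) \<in> borel_measurable fset_algebra"
    by (rule measurable_emeasure_Pair)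
  then have "(\<lambda>S. (emeasure mu (Pair S -` ((\<lambda>(x, y). (y, x)) -` {(x, S). finite S \<and> x \<in> interior (convex hull S)} \<inter>
      space (fset_algebra \<Otimes>\<^sub>M mu)))) ^ k) \<in> borel_measurable fset_algebra"
    by (rule borel_measurable_power_ennreal)
  also have "?this \<longleftrightarrow> ?thesis"
  proof (rule measurable_cong)
    fix S :: "'a set" assume "S \<in> space fset_algebra"
    then have "finite S" by simp
    moreover from this have "Pair S -` ((\<lambda>(x, y). (y, x)) -` {(x, S). finite S \<and> x \<in> interior (convex hull S)} \<inter>
      space (fset_algebra \<Otimes>\<^sub>M mu)) = interior (convex hull S)"
      using sets_eq_imp_space_eq[OF sets] by (auto simp: space_pair_measure)
    ultimately show "(emeasure mu (Pair S -` ((\<lambda>(x, y). (y, x)) -` {(x, S). finite S \<and> x \<in> interior (convex hull S)} \<inter>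
      space (fset_algebra \<Otimes>\<^sub>M mu)))) ^ k = ennreal (measure mu (convex hull S) ^ k)"
      using emeasure_interior_convex_hull[OF assms(2,3)]
      by (simp add: emeasure_eq_measure ennreal_power)
  qed
  finally show ?thesis .
qed

text \<open>The count is the sum, over the points of \<open>S\<close>, of the indicator of the
  measurable interior relation.\<close>

lemma measurable_interior_count:
  "(\<lambda>S. interior_count S) \<in> measurable (fset_algebra :: 'a::euclidean_space set measure) (count_space UNIV)"
proof -
  note [measurable] = borel_measurable_sum_points[OF interior_convex_hull_in_sets_pair]
  let ?N = "\<lambda>S::'a set. \<Sum>x\<in>S. indicator {(x, S). finite S \<and> x \<in> interior (convex hull S)} (x, S) :: ennreal"
  have "?N S = of_nat (interior_count S)" if "S \<in> space fset_algebra" for S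
    using that by (simp add: interior_count_def indicator_def sum.If_cases Int_def conj_commute)
  then have *: "(\<lambda>S. interior_count S) -` {m} \<inter> space fset_algebra = {S \<in> space fset_algebra. ?N S = of_nat m}" for m
    by auto
  have "{S \<in> space fset_algebra. ?N S = of_nat m} \<in> sets fset_algebra" for m
    by measurable
  then show ?thesis
    unfolding measurable_count_space_eq2_countable * by auto
qed

section \<open>Distinct sample points and counting by indices\<close>

text \<open>For each of the finitely many pairs of indices, Fubini reduces a coincidence to the
  measure of a singleton.\<close>

lemma AE_PiM_inj_on:
  fixes mu :: "'a::euclidean_space measure"
  assumes "prob_space mu" and sets: "sets mu = sets borel" and null: "\<And>a. emeasure mu {a} = 0"
    and I: "finite I"
  shows "AE x in (\<Pi>\<^sub>M i\<in>I. mu). inj_on x I"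
proof -
  interpret prob_space mu by fact
  interpret product_sigma_finite "\<lambda>_. mu" by unfold_locales
  note [measurable_cong] = sets
  have "AE x in (\<Pi>\<^sub>M i\<in>I. mu). x i \<noteq> x j" if ij: "i \<in> I" "j \<in> I" "i \<noteq> j" for i j
  proof -
    have [measurable]: "(\<lambda>x. x i) \<in> borel_measurable (\<Pi>\<^sub>M i\<in>I. mu)" "(\<lambda>x. x j) \<in> borel_measurable (\<Pi>\<^sub>M i\<in>I. mu)"
      using measurable_component_singleton[of _ I "\<lambda>_. mu"] ij by (simp_all add: measurable_cong_sets[OF refl sets])
    have m[measurable]: "{x \<in> space (\<Pi>\<^sub>M i\<in>I. mu). x i = x j} \<in> sets (\<Pi>\<^sub>M i\<in>I. mu)"
      by measurable
    define I' where "I' = I - {i}"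
    have I': "insert i I' = I" "finite I'" "i \<notin> I'" using ij I by (auto simp: I'_def)
    have "emeasure (\<Pi>\<^sub>M i\<in>I. mu) {x \<in> space (\<Pi>\<^sub>M i\<in>I. mu). x i = x j} =
        (\<integral>\<^sup>+ x. indicator {x \<in> space (\<Pi>\<^sub>M i\<in>I. mu). x i = x j} x \<partial>(\<Pi>\<^sub>M i\<in>I. mu))"
      using m by simp
    also have "\<dots> = (\<integral>\<^sup>+ x. \<integral>\<^sup>+ y. indicator {x \<in> space (\<Pi>\<^sub>M i\<in>I. mu). x i = x j} (x(i := y)) \<partial>mu \<partial>(\<Pi>\<^sub>M i\<in>I'. mu))"
      using product_nn_integral_insert[OF I'(2,3), of "indicator {x \<in> space (\<Pi>\<^sub>M i\<in>I. mu). x i = x j}"] m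
      by (simp add: I'(1) del: nn_integral_indicator)
    \<comment> \<open>Since \<open>j\<close> differs from \<open>i\<close>, updating coordinate
      \<open>i\<close> leaves \<open>x j\<close> fixed, and coincidence forces
      \<open>y = x j\<close>.\<close>
    also have "\<dots> \<le> (\<integral>\<^sup>+ x. \<integral>\<^sup>+ y. indicator {x j} y \<partial>mu \<partial>(\<Pi>\<^sub>M i\<in>I'. mu))"
      using ij by (intro nn_integral_mono) (auto simp: indicator_def)
    also have "\<dots> = 0" using null sets by simp
    finally have "emeasure (\<Pi>\<^sub>M i\<in>I. mu) {x \<in> space (\<Pi>\<^sub>M i\<in>I. mu). x i = x j} = 0" by simp
    then show ?thesis using m by (intro AE_I[OF _ _ m]) auto
  qed
  then have "AE x in (\<Pi>\<^sub>M i\<in>I. mu). \<forall>i\<in>I. \<forall>j\<in>I. i \<noteq> j \<longrightarrow> x i \<noteq> x j"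
    using I by (intro AE_finite_allI) auto
  then show ?thesis by eventually_elim (auto simp: inj_on_def)
qed

text \<open>Passes from ordered to unordered selections. Truncated subtraction is harmless: for
  \<open>k > n\<close> a zero factor matches the vanishing binomial coefficient.\<close>

lemma falling_fact_eq_binomial: "falling_fact n k = fact k * (n choose k)"
proof (induction k)
  case (Suc k)
  have "falling_fact n (Suc k) = fact k * ((n - k) * (n choose k))"
    using Suc by (simp add: falling_fact_def)
  also have "(n - k) * (n choose k) = Suc k * (n choose Suc k)"
    by (simp only: binomial_absorb_comp binomial_absorption)
  finally show ?case by (simp only: fact_Suc of_nat_id mult_ac)
qed (simp add: falling_fact_def)

text \<open>Reindexing along a bijection preserves a product of identical measures and the set of
  sample points. Thus the indices left after removing \<open>K\<close> may be replaced by an initial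
  segment.\<close>

lemma nn_integral_PiM_image_cong_card:
  fixes I :: "'i set" and J :: "'j set" and mu :: "'a::topological_space measure"
  assumes mu: "prob_space mu" "sets mu = sets borel"
    and f: "f \<in> borel_measurable fset_algebra" and "finite I" "finite J" "card I = card J"
  shows "(\<integral>\<^sup>+ x. f (x ` I) \<partial>(\<Pi>\<^sub>M i\<in>I. mu)) = (\<integral>\<^sup>+ x. f (x ` J) \<partial>(\<Pi>\<^sub>M i\<in>J. mu))"
proof -
  obtain h where h: "bij_betw h I J"
    using assms(4-6) by (meson bij_betw_iff_card)
  let ?r = "\<lambda>x. \<lambda>i\<in>I. x (h i)"
  have meas: "(\<lambda>x. f (x ` I)) \<in> borel_measurable (\<Pi>\<^sub>M i\<in>I. mu)"
    by (rule measurable_compose[OF measurable_image_fset_algebra f]) fact+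
  have "distr (\<Pi>\<^sub>M i\<in>J. mu) (\<Pi>\<^sub>M i\<in>I. mu) ?r = (\<Pi>\<^sub>M i\<in>I. mu)"
    using h mu by (intro distr_PiM_reindex) (auto simp: bij_betw_def)
  then have "(\<integral>\<^sup>+ x. f (x ` I) \<partial>(\<Pi>\<^sub>M i\<in>I. mu)) =
      (\<integral>\<^sup>+ x. f (x ` I) \<partial>distr (\<Pi>\<^sub>M i\<in>J. mu) (\<Pi>\<^sub>M i\<in>I. mu) ?r)"
    by simp
  also have "\<dots> = (\<integral>\<^sup>+ x. f (?r x ` I) \<partial>(\<Pi>\<^sub>M i\<in>J. mu))"
    using h meas by (intro nn_integral_distr measurable_restrict measurable_component_singleton)
      (auto simp: bij_betw_def)
  also have "\<dots> = (\<integral>\<^sup>+ x. f (x ` J) \<partial>(\<Pi>\<^sub>M i\<in>J. mu))"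
  proof (intro nn_integral_cong arg_cong[where f = f])
    show "?r x ` I = x ` J" for x :: "'j \<Rightarrow> 'a"
      using h by (auto simp: bij_betw_def image_image cong: image_cong)
  qed
  finally show ?thesis .
qed

lemma sets_PiM_interior_indices:
  fixes mu :: "'a::euclidean_space measure"
  assumes sets: "sets mu = sets borel" and "finite I" "K \<subseteq> I"
  shows "{x \<in> space (\<Pi>\<^sub>M i\<in>I. mu). \<forall>i\<in>K. x i \<in> interior (convex hull (x ` I))} \<in> sets (\<Pi>\<^sub>M i\<in>I. mu)"
proof (rule sets.sets_Collect_finite_All)
  fix i assume "i \<in> K"
  then have "i \<in> I" using assms by auto
  then have "(\<lambda>x. x i) \<in> borel_measurable (\<Pi>\<^sub>M i\<in>I. mu)"
    using measurable_component_singleton[of i I "\<lambda>_. mu"]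
    by (simp add: measurable_cong_sets[OF refl sets])
  then have "(\<lambda>x. (x i, x ` I)) \<in> measurable (\<Pi>\<^sub>M i\<in>I. mu) (borel \<Otimes>\<^sub>M fset_algebra)"
    using assms by (intro measurable_Pair measurable_image_fset_algebra) auto
  from measurable_sets[OF this interior_convex_hull_in_sets_pair]
  show "{x \<in> space (\<Pi>\<^sub>M i\<in>I. mu). x i \<in> interior (convex hull (x ` I))} \<in> sets (\<Pi>\<^sub>M i\<in>I. mu)"
    using \<open>finite I\<close> by (auto elim!: back_subst[of "\<lambda>X. X \<in> sets _"])
qed (use assms finite_subset in auto)

text \<open>Fubini with the points outside \<open>K\<close> fixed: the event for the points in
  \<open>K\<close> then becomes a product set, whose factors are all the interior of the fixed
  hull.\<close>

lemma emeasure_PiM_interior_indices: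
  fixes mu :: "'a::euclidean_space measure"
  assumes mu: "prob_space mu" "absolutely_continuous lborel mu" "sets mu = sets borel"
    and I: "finite I" "K \<subseteq> I"
  shows "emeasure (\<Pi>\<^sub>M i\<in>I. mu) {x \<in> space (\<Pi>\<^sub>M i\<in>I. mu). \<forall>i\<in>K. x i \<in> interior (convex hull (x ` I))}
    = (\<integral>\<^sup>+ y. ennreal (measure mu (convex hull (y ` (I - K))) ^ card K) \<partial>(\<Pi>\<^sub>M i\<in>I - K. mu))"
proof -
  interpret prob_space mu by fact
  interpret product_sigma_finite "\<lambda>_. mu" by unfold_locales
  define L where "L = I - K"
  have L: "L \<union> K = I" "L \<inter> K = {}" "finite L" "finite K"
    using I by (auto simp: L_def intro: finite_subset)
  have space: "space mu = UNIV" using sets_eq_imp_space_eq[OF mu(3)] by simp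
  let ?H = "{x \<in> space (\<Pi>\<^sub>M i\<in>I. mu). \<forall>i\<in>K. x i \<in> interior (convex hull (x ` I))}"
  note H = sets_PiM_interior_indices[OF mu(3) I]
  have "emeasure (\<Pi>\<^sub>M i\<in>I. mu) ?H = (\<integral>\<^sup>+ x. indicator ?H x \<partial>(\<Pi>\<^sub>M i\<in>L \<union> K. mu))"
    using H by (simp add: L)
  also have "\<dots> = (\<integral>\<^sup>+ y. \<integral>\<^sup>+ z. indicator ?H (merge L K (y, z)) \<partial>(\<Pi>\<^sub>M i\<in>K. mu) \<partial>(\<Pi>\<^sub>M i\<in>L. mu))"
    using H L by (intro product_nn_integral_fold) auto
  also have "\<dots> = (\<integral>\<^sup>+ y. ennreal (measure mu (convex hull (y ` L)) ^ card K) \<partial>(\<Pi>\<^sub>M i\<in>L. mu))"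
  proof (rule nn_integral_cong)
    fix y assume y: "y \<in> space (\<Pi>\<^sub>M i\<in>L. mu)"
    let ?P = "\<Pi>\<^sub>E i\<in>K. interior (convex hull (y ` L))"
    have "indicator ?H (merge L K (y, z)) = (indicator ?P z :: ennreal)" if z: "z \<in> space (\<Pi>\<^sub>M i\<in>K. mu)" for z
    proof -
      have img: "merge L K (y, z) ` I = y ` L \<union> z ` K"
        using L(2) unfolding L(1)[symmetric] image_Un
        by (intro arg_cong2[where f = "(\<union>)"] image_cong) (auto simp: merge_def)
      have "merge L K (y, z) \<in> space (\<Pi>\<^sub>M i\<in>I. mu)"
        using space by (auto simp: space_PiM PiE_iff merge_def extensional_def L(1)[symmetric])
      moreover have "(\<forall>i\<in>K. merge L K (y, z) i \<in> X) \<longleftrightarrow> z ` K \<subseteq> X" for X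
        using L(2) by (auto simp: merge_def)
      ultimately have "merge L K (y, z) \<in> ?H \<longleftrightarrow> z ` K \<subseteq> interior (convex hull (y ` L \<union> z ` K))"
        by (simp add: img)
      \<comment> \<open>The Krein-Milman step: the hull stops depending on \<open>z\<close>.\<close>
      also have "\<dots> \<longleftrightarrow> z ` K \<subseteq> interior (convex hull (y ` L))"
        using L by (intro subset_interior_convex_hull_Un_iff) auto
      also have "\<dots> \<longleftrightarrow> z \<in> ?P"
        using z by (auto simp: space_PiM PiE_iff)
      finally show ?thesis by (simp add: indicator_def)
    qed
    then have "(\<integral>\<^sup>+ z. indicator ?H (merge L K (y, z)) \<partial>(\<Pi>\<^sub>M i\<in>K. mu)) = (\<integral>\<^sup>+ z. indicator ?P z \<partial>(\<Pi>\<^sub>M i\<in>K. mu))"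
      by (rule nn_integral_cong)
    also have "\<dots> = emeasure (\<Pi>\<^sub>M i\<in>K. mu) ?P"
      using L mu(3) by (intro nn_integral_indicator sets_PiM_I_finite) auto
    also have "\<dots> = (\<Prod>i\<in>K. emeasure mu (interior (convex hull (y ` L))))"
      using L mu(3) by (intro emeasure_PiM) auto
    also have "\<dots> = ennreal (measure mu (convex hull (y ` L)) ^ card K)"
      using emeasure_interior_convex_hull[OF mu(2,3), of "y ` L"] L
      by (simp add: emeasure_eq_measure ennreal_power)
    finally show "(\<integral>\<^sup>+ z. indicator ?H (merge L K (y, z)) \<partial>(\<Pi>\<^sub>M i\<in>K. mu)) =
      ennreal (measure mu (convex hull (y ` L)) ^ card K)" .
  qed
  finally show ?thesis by (simp add: L_def)
qed

text \<open>Injectivity identifies interior points with their indices, so sets of points can be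
  counted as sets of indices.\<close>

lemma interior_count_image_choose:
  fixes x :: "'i \<Rightarrow> 'a::euclidean_space"
  assumes "inj_on x I" "finite I"
  shows "interior_count (x ` I) choose k =
    card {K. K \<subseteq> I \<and> card K = k \<and> (\<forall>i\<in>K. x i \<in> interior (convex hull (x ` I)))}"
proof -
  define J where "J = {i \<in> I. x i \<in> interior (convex hull (x ` I))}"
  have "{y \<in> x ` I. y \<in> interior (convex hull (x ` I))} = x ` J" by (auto simp: J_def)
  moreover have "inj_on x J" using assms(1) by (auto simp: J_def inj_on_def)
  ultimately have "interior_count (x ` I) = card J"
    by (simp add: interior_count_def card_image)
  moreover have "{K. K \<subseteq> I \<and> card K = k \<and> (\<forall>i\<in>K. x i \<in> interior (convex hull (x ` I)))}
      = {K. K \<subseteq> J \<and> card K = k}"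
    by (auto simp: J_def)
  ultimately show ?thesis using assms(2) by (simp add: n_subsets J_def)
qed

text \<open>The falling factorial is almost surely \<open>fact k\<close> times a sum of indicators
  over the k-element index sets, which all contribute equally. For \<open>k > n\<close> there are
  none, and the binomial coefficient on the right is zero as well.\<close>

lemma nn_integral_falling_fact_interior_count:
  fixes mu :: "'a::euclidean_space measure"
  assumes mu: "prob_space mu" "absolutely_continuous lborel mu" "sets mu = sets borel"
  shows "(\<integral>\<^sup>+ x. ennreal (real (falling_fact (interior_count (x ` {..<n})) k)) \<partial>(\<Pi>\<^sub>M i\<in>{..<n}. mu)) =
    of_nat (fact k * (n choose k)) *
      (\<integral>\<^sup>+ x. ennreal (measure mu (convex hull (x ` {..<n - k})) ^ k) \<partial>(\<Pi>\<^sub>M i\<in>{..<n - k}. mu))"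
proof -
  let ?I = "{..<n}"
  let ?H = "\<lambda>K. {x \<in> space (\<Pi>\<^sub>M i\<in>?I. mu). \<forall>i\<in>K. x i \<in> interior (convex hull (x ` ?I))}"
  let ?C = "{K. K \<subseteq> ?I \<and> card K = k}"
  let ?a = "\<integral>\<^sup>+ x. ennreal (measure mu (convex hull (x ` {..<n - k})) ^ k) \<partial>(\<Pi>\<^sub>M i\<in>{..<n - k}. mu)"
  have fin: "finite ?C" by (rule finite_subset[of _ "Pow ?I"]) auto
  have null: "emeasure mu {a} = 0" for a
  proof -
    have "{a} \<in> null_sets lborel" by (simp add: null_sets_def)
    then show ?thesis using mu(2) by (auto simp: absolutely_continuous_def)
  qed
  have "AE x in (\<Pi>\<^sub>M i\<in>?I. mu). ennreal (real (falling_fact (interior_count (x ` ?I)) k)) =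
      of_nat (fact k) * (\<Sum>K\<in>?C. indicator (?H K) x)"
    using AE_PiM_inj_on[OF mu(1,3) null finite_lessThan] AE_space
  proof eventually_elim
    case (elim x)
    have "?C \<inter> {K. \<forall>i\<in>K. x i \<in> interior (convex hull (x ` ?I))} =
        {K. K \<subseteq> ?I \<and> card K = k \<and> (\<forall>i\<in>K. x i \<in> interior (convex hull (x ` ?I)))}" by auto
    then have "(\<Sum>K\<in>?C. indicator (?H K) x :: ennreal) = of_nat (interior_count (x ` ?I) choose k)"
      using fin elim by (simp add: indicator_def sum.If_cases interior_count_image_choose[OF elim(1)])
    then show ?case
      by (simp add: falling_fact_eq_binomial ennreal_of_nat_eq_real_of_nat ennreal_mult'
          del: of_nat_fact)
  qed
  then have "(\<integral>\<^sup>+ x. ennreal (real (falling_fact (interior_count (x ` ?I)) k)) \<partial>(\<Pi>\<^sub>M i\<in>?I. mu)) =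
      (\<integral>\<^sup>+ x. of_nat (fact k) * (\<Sum>K\<in>?C. indicator (?H K) x) \<partial>(\<Pi>\<^sub>M i\<in>?I. mu))"
    by (rule nn_integral_cong_AE)
  also have "\<dots> = of_nat (fact k) * (\<integral>\<^sup>+ x. (\<Sum>K\<in>?C. indicator (?H K) x) \<partial>(\<Pi>\<^sub>M i\<in>?I. mu))"
    using sets_PiM_interior_indices[OF mu(3), of ?I]
    by (intro nn_integral_cmult borel_measurable_sum borel_measurable_indicator) auto
  also have "(\<integral>\<^sup>+ x. (\<Sum>K\<in>?C. indicator (?H K) x) \<partial>(\<Pi>\<^sub>M i\<in>?I. mu)) =
      (\<Sum>K\<in>?C. \<integral>\<^sup>+ x. indicator (?H K) x \<partial>(\<Pi>\<^sub>M i\<in>?I. mu))"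
    using sets_PiM_interior_indices[OF mu(3), of ?I]
    by (intro nn_integral_sum borel_measurable_indicator) auto
  also have "\<dots> = (\<Sum>K\<in>?C. ?a)"
  proof (rule sum.cong)
    fix K assume K: "K \<in> ?C"
    then have "finite K" using finite_subset by auto
    then have card: "card (?I - K) = card {..<n - k}" using K by (simp add: card_Diff_subset)
    have "(\<integral>\<^sup>+ x. indicator (?H K) x \<partial>(\<Pi>\<^sub>M i\<in>?I. mu)) = emeasure (\<Pi>\<^sub>M i\<in>?I. mu) (?H K)"
      using K sets_PiM_interior_indices[OF mu(3), of ?I] by (intro nn_integral_indicator) auto
    also have "\<dots> = (\<integral>\<^sup>+ y. ennreal (measure mu (convex hull (y ` (?I - K))) ^ k) \<partial>(\<Pi>\<^sub>M i\<in>?I - K. mu))"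
      using emeasure_PiM_interior_indices[OF mu, of ?I K] K by simp
    also have "\<dots> = ?a"
      by (rule nn_integral_PiM_image_cong_card[OF mu(1,3) measurable_measure_convex_hull[OF mu] _ _ card]) auto
    finally show "(\<integral>\<^sup>+ x. indicator (?H K) x \<partial>(\<Pi>\<^sub>M i\<in>?I. mu)) = ?a" .
  qed simp
  also have "\<dots> = of_nat (n choose k) * ?a"
    using n_subsets[of ?I k] by simp
  finally show ?thesis by (simp add: mult.assoc)
qed

section \<open>Summation over the sample size\<close>

theorem theorem2:
  fixes M :: "'w measure" and eta :: "'w \<Rightarrow> 'a::euclidean_space set"
    and mu :: "'a measure" and t :: real and k :: nat
  assumes "prob_space mu"
    and "sets mu = sets borel"
    and "absolutely_continuous lborel mu"
    and "t > 0"
    and "poisson_process M eta mu t"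
  shows "(\<integral>\<^sup>+ \<omega>. ennreal (real (falling_fact (interior_count (eta \<omega>)) k)) \<partial>M)
         = ennreal (t ^ k) * (\<integral>\<^sup>+ \<omega>. ennreal (measure mu (convex hull (eta \<omega>)) ^ k) \<partial>M)"
proof -
  note integral = nn_integral_poisson_process[OF assms(1,2,4,5)]
  define a where "a m = (\<integral>\<^sup>+ x. ennreal (measure mu (convex hull (x ` {..<m})) ^ k)
    \<partial>(\<Pi>\<^sub>M i\<in>{..<m}. mu))" for m :: nat
  define w where "w n = t ^ n / fact n * exp (- t)" for n :: nat
  define b where "b n = ennreal (w n) * (of_nat (fact k * (n choose k)) * a (n - k))" for n
  have "(\<lambda>S. ennreal (real (falling_fact (interior_count S) k))) \<in> borel_measurable (fset_algebra :: 'a set measure)"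
    by (rule measurable_compose[OF measurable_interior_count]) simp
  from integral[OF this]
  have "(\<integral>\<^sup>+ \<omega>. ennreal (real (falling_fact (interior_count (eta \<omega>)) k)) \<partial>M) = (\<Sum>n. b n)"
    by (simp only: nn_integral_falling_fact_interior_count[OF assms(1,3,2)] b_def a_def w_def)
  \<comment> \<open>The terms with \<open>n < k\<close> vanish, so the sum may run over the number
    \<open>m = n - k\<close> of remaining points.\<close>
  also have "\<dots> = (\<Sum>m. b (m + k))"
  proof (rule suminf_mono_reindex[symmetric])
    fix n assume "n \<notin> range (\<lambda>m. m + k)"
    then have "n < k" by (metis le_add_diff_inverse2 not_le rangeI)
    then show "b n = 0" by (simp add: b_def binomial_eq_0)
  qed (simp add: strict_mono_def)
  also have "\<dots> = (\<Sum>m. ennreal (t ^ k) * (ennreal (w m) * a m))"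
  proof (rule suminf_cong)
    fix m
    \<comment> \<open>The factor \<open>fact k * (m + k choose k)\<close> turns the denominator
      \<open>fact (m + k)\<close> of the Poisson weight into \<open>fact m\<close>, leaving
      \<open>t ^ k\<close> times the weight of \<open>m\<close>.\<close>
    have "fact k * fact m * (m + k choose k) = (fact (m + k) :: nat)"
      using binomial_fact_lemma[of k "m + k"] by simp
    then have "fact k * fact m * real (m + k choose k) = fact (m + k)"
      by (metis of_nat_fact of_nat_mult)
    then have "w (m + k) * real (fact k * (m + k choose k)) = t ^ k * w m"
      by (simp add: w_def power_add field_simps)
    moreover have "0 \<le> w m" for m using assms(4) by (simp add: w_def)
    ultimately have "ennreal (w (m + k)) * of_nat (fact k * (m + k choose k)) = ennreal (t ^ k) * ennreal (w m)"
      using assms(4) by (simp add: ennreal_of_nat_eq_real_of_nat flip: ennreal_mult')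
    then show "b (m + k) = ennreal (t ^ k) * (ennreal (w m) * a m)"
      by (simp add: b_def mult.assoc[symmetric])
  qed
  also have "\<dots> = ennreal (t ^ k) * (\<Sum>m. ennreal (w m) * a m)"
    by (rule ennreal_suminf_cmult)
  \<comment> \<open>The mixture formula is read backwards, now for the power of the hull
    measure.\<close>
  also have "(\<Sum>m. ennreal (w m) * a m) = (\<integral>\<^sup>+ \<omega>. ennreal (measure mu (convex hull (eta \<omega>)) ^ k) \<partial>M)"
    using integral[OF measurable_measure_convex_hull[OF assms(1,3,2)], of k] by (simp add: a_def w_def)
  finally show ?thesis .
qed

end
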